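(* Let $\Phi:[0,\infty)\to[0,\infty)$ be a continuous function such that (1) $\Phi$ is increasing on $[0,\infty)$ and $\Phi(0)=0$; (2) $t\mapsto\Phi(t^{1/2})$ is concave on $[0,\infty)$; (3) there is a non-negative function $b(\lambda)$, $\lambda\ge1$, with $\lim_{\lambda\to\infty}b(\lambda)=0$ and $\Phi(\lambda^{-1}t)\le b(\lambda)\Phi(t)$ for all $\lambda\ge1$, $t\ge0$; (4) $\lim_{t\to\infty}\Phi(t)=\infty$. Let $T$ be a sublinear operator from $L^\Phi(\mathbf R^n)$ into the space of measurable functions on $\mathbf R^n$ which is continuous in measure, translation-invariant and dilation-invariant on $L^\Phi(\mathbf R^n)$. Then there exists a constant $A>0$ such that $$\left|\left\{x\in\mathbf R^n:|Tf(x)|>\lambda\right\}\right|\le\int_{\mathbf R^n}\Phi\left(\frac{A|f(x)|}{\lambda}\right)dx$$ for all $\lambda>0$ and all $f\in L^\Phi(\mathbf R^n)$.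
   Context: $\mathbf R^n$ carries Lebesgue measure, denoted $|\cdot|$. $L^\Phi(\mathbf R^n)$ is the set of measurable functions $f$ on $\mathbf R^n$ with $\|f\|_\Phi:=\int_{\mathbf R^n}\Phi(|f|)\,dx<\infty$ (a vector space under the hypotheses on $\Phi$). Sublinear: $|T(f+g)|\le|T(f)|+|T(g)|$ and $|T(cf)|=|c||T(f)|$ for all $f,g\in L^\Phi(\mathbf R^n)$ and all scalars $c$. Continuous in measure: for every set $E\subset\mathbf R^n$ of finite measure there is a non-negative function $C_E(\lambda)$, $\lambda>0$, with $\lim_{\lambda\to\infty}C_E(\lambda)=0$ and $|\{x\in E:|Tf(x)|>\lambda\}|\le C_E(\lambda)$ for all $\lambda>0$ and all $f$ with $\|f\|_\Phi=1$. Translation-invariant: $T(\tau_hf)=\tau_h(Tf)$ for all $h\in\mathbf R^n$, where $\tau_hf(x)=f(x-h)$. Dilation-invariant: $T(d_rf)=d_r(Tf)$ for all $r>0$, where $d_rf(x)=f(rx)$. *)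

theory Defs
  imports "HOL-Analysis.Analysis"
begin

text \<open>
  Scalars range over a type of sort \<open>{real_normed_field, euclidean_space}\<close>, which covers both
  real-valued and complex-valued functions; \<open>norm\<close> is then the absolute value.

  Members of the function spaces are functions, not equivalence classes, so (in)equalities between
  values of an operator are required almost everywhere, for each fixed choice of the functions,
  scalars, translations and dilations involved. An operator is a total HOL function of which only
  the values on the given class are constrained.
\<close>

type_synonym ('n, 'b) fn = "real ^ 'n \<Rightarrow> 'b"

definition Phi_norm :: "(real \<Rightarrow> real) \<Rightarrow> ('n::finite, 'b::real_normed_vector) fn \<Rightarrow> ennreal" where
  "Phi_norm \<Phi> f = (\<integral>\<^sup>+ x. ennreal (\<Phi> (norm (f x))) \<partial>lebesgue)"

definition L_Phi :: "(real \<Rightarrow> real) \<Rightarrow> ('n::finite, 'b::real_normed_vector) fn set" where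
  "L_Phi \<Phi> = {f \<in> borel_measurable lebesgue. Phi_norm \<Phi> f < \<infinity>}"

definition translate :: "real ^ 'n \<Rightarrow> ('n::finite, 'b) fn \<Rightarrow> ('n, 'b) fn" where
  "translate h f = (\<lambda>x. f (x - h))"

definition dilate :: "real \<Rightarrow> ('n::finite, 'b) fn \<Rightarrow> ('n, 'b) fn" where
  "dilate r f = (\<lambda>x. f (r *\<^sub>R x))"

definition sublinear_on ::
  "('n::finite, 'b::real_normed_field) fn set \<Rightarrow> (('n, 'b) fn \<Rightarrow> ('n, 'b) fn) \<Rightarrow> bool" where
  "sublinear_on L T \<longleftrightarrow>
     (\<forall>f\<in>L. \<forall>g\<in>L. AE x in lebesgue. norm (T (\<lambda>y. f y + g y) x) \<le> norm (T f x) + norm (T g x)) \<and>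
     (\<forall>f\<in>L. \<forall>c. AE x in lebesgue. norm (T (\<lambda>y. c * f y) x) = norm c * norm (T f x))"

definition continuous_in_measure ::
  "(real \<Rightarrow> real) \<Rightarrow> (('n::finite, 'b::real_normed_vector) fn \<Rightarrow> ('n, 'b) fn) \<Rightarrow> bool" where
  "continuous_in_measure \<Phi> T \<longleftrightarrow>
     (\<forall>E \<in> sets lebesgue. emeasure lebesgue E < \<infinity> \<longrightarrow>
        (\<exists>C :: real \<Rightarrow> real.
           (\<forall>l>0. C l \<ge> 0) \<and> (C \<longlongrightarrow> 0) at_top \<and>
           (\<forall>l>0. \<forall>f\<in>L_Phi \<Phi>. Phi_norm \<Phi> f = 1 \<longrightarrow>
              emeasure lebesgue {x \<in> E. norm (T f x) > l} \<le> ennreal (C l))))"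

definition translation_invariant_on ::
  "('n::finite, 'b) fn set \<Rightarrow> (('n, 'b) fn \<Rightarrow> ('n, 'b) fn) \<Rightarrow> bool" where
  "translation_invariant_on L T \<longleftrightarrow>
     (\<forall>f\<in>L. \<forall>h. AE x in lebesgue. T (translate h f) x = translate h (T f) x)"

definition dilation_invariant_on ::
  "('n::finite, 'b) fn set \<Rightarrow> (('n, 'b) fn \<Rightarrow> ('n, 'b) fn) \<Rightarrow> bool" where
  "dilation_invariant_on L T \<longleftrightarrow>
     (\<forall>f\<in>L. \<forall>r>0. AE x in lebesgue. T (dilate r f) x = dilate r (T f) x)"

end

theory Submission
  imports Defs
begin

text \<open>
  By dilations and homogeneity it suffices to treat \<open>g\<close> in the class with
  \<open>S = {|T g| > 1}\<close> inside the cube \<open>[-1,1]^n\<close> and to bound \<open>|S|\<close> by a constant times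
  \<open>\<integral> \<Phi>(c |g|)\<close>; condition (3) then absorbs the constant into the argument of \<open>\<Phi>\<close>.
  About \<open>1/|S|\<close> translates of \<open>S\<close>, chosen greedily, cover half of the unit cube.
  Let \<open>f\<^sub>i\<close> be the corresponding translates of \<open>g\<close> and consider the sums
  \<open>F = \<Sum>\<^sub>i \<plusminus> f\<^sub>i\<close>. Since flipping the \<open>i\<close>-th sign changes \<open>F\<close> by \<open>2 f\<^sub>i\<close>, for every point of
  the covered half at least half of all choices of signs give \<open>|T F| > 1\<close> there. On the other
  hand, concavity of \<open>\<Phi>(t^(1/2))\<close> and the parallelogram law show that on average over the signs
  \<open>\<integral> \<Phi>(c |F|) \<le> \<Sum>\<^sub>i \<integral> \<Phi>(c |f\<^sub>i|)\<close>. Continuity in measure says that \<open>T F\<close> can exceed \<open>1\<close> on a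
  substantial part of the unit cube only if \<open>\<integral> \<Phi>(c |F|) \<ge> 1\<close>.
\<close>

section \<open>Affine changes of variables for Lebesgue measure\<close>

lemma lebesgue_scaleR_affine_measurable:
  fixes t :: "'a::euclidean_space"
  assumes "c \<noteq> 0"
  shows "(\<lambda>x. t + c *\<^sub>R x) \<in> lebesgue \<rightarrow>\<^sub>M lebesgue"
  \<comment> \<open>The library map scales each coordinate by its own factor; with all factors equal
    to \<open>c\<close>, the sum over \<open>Basis\<close> collapses to
    \<open>c *\<^sub>R x\<close>.\<close>
  using lebesgue_affine_measurable[of "\<lambda>_::'a. c" t] assms
  unfolding scaleR_scaleR[symmetric] scaleR_sum_right[symmetric] euclidean_representation
  by simp

lemma nn_integral_lebesgue_affine:
  fixes t :: "'a::euclidean_space"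
  assumes [measurable]: "f \<in> borel_measurable lebesgue" and c: "c \<noteq> 0"
  shows "(\<integral>\<^sup>+x. f x \<partial>lebesgue) = ennreal (\<bar>c\<bar> ^ DIM('a)) * (\<integral>\<^sup>+x. f (t + c *\<^sub>R x) \<partial>lebesgue)"
proof -
  note [measurable] = lebesgue_scaleR_affine_measurable[OF c, of t]
  have "lebesgue = density (distr lebesgue lebesgue (\<lambda>x. t + c *\<^sub>R x)) (\<lambda>_. \<Prod>j\<in>(Basis::'a set). \<bar>c\<bar>)"
    using lebesgue_affine_euclidean[of "\<lambda>_::'a. c" t] c
    unfolding scaleR_scaleR[symmetric] scaleR_sum_right[symmetric] euclidean_representation
    by simp
  then have "(\<integral>\<^sup>+x. f x \<partial>lebesgue)
      = (\<integral>\<^sup>+x. f x \<partial>density (distr lebesgue lebesgue (\<lambda>x. t + c *\<^sub>R x)) (\<lambda>_. ennreal (\<bar>c\<bar> ^ DIM('a))))"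
    by simp
  also have "\<dots> = (\<integral>\<^sup>+x. ennreal (\<bar>c\<bar> ^ DIM('a)) * f x \<partial>distr lebesgue lebesgue (\<lambda>x. t + c *\<^sub>R x))"
    by (subst nn_integral_density) auto
  also have "\<dots> = (\<integral>\<^sup>+x. ennreal (\<bar>c\<bar> ^ DIM('a)) * f (t + c *\<^sub>R x) \<partial>lebesgue)"
    by (subst nn_integral_distr) auto
  also have "\<dots> = ennreal (\<bar>c\<bar> ^ DIM('a)) * (\<integral>\<^sup>+x. f (t + c *\<^sub>R x) \<partial>lebesgue)"
    by (subst nn_integral_cmult) auto
  finally show ?thesis .
qed

section \<open>Covering half of the unit cube by translates of a set\<close>

lemma ennreal_3_power: "(3::ennreal) ^ n = ennreal (3 ^ n)"
  by (simp add: ennreal_power[symmetric])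

text \<open>Averaging over h: by Fubini, the measure of R intersected with S + h integrates over all
  h to |R| |S|, and it vanishes unless h lies in [-1,2]^n, a cube of volume 3^n. So some h does at
  least as well as the average |R| |S| / 3^n over that cube.\<close>

lemma exists_translate_overlap:
  fixes R S :: "'a::euclidean_space set"
  assumes [measurable]: "R \<in> sets borel" "S \<in> sets borel"
    and R: "R \<subseteq> cbox 0 One" and S: "S \<subseteq> cbox (-One) One"
  shows "\<exists>h. measure lborel R * measure lborel S \<le> 3 ^ DIM('a) * measure lborel {x\<in>R. x - h \<in> S}"
proof (rule ccontr)
  assume "\<not> ?thesis"
  then have less: "3 ^ DIM('a) * measure lborel {x\<in>R. x - h \<in> S} < measure lborel R * measure lborel S" for h
    by (simp add: not_le)
  define p where "p = measure lborel R * measure lborel S"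
  define Q :: "'a set" where "Q = cbox (-One) (2 *\<^sub>R One)"
  have [measurable]: "Q \<in> sets borel" by (simp add: Q_def)
  have Q: "emeasure lborel Q = 3 ^ DIM('a)"
  proof -
    have "(\<Prod>b\<in>(Basis::'a set). (2 *\<^sub>R One - - One) \<bullet> b) = (\<Prod>b\<in>(Basis::'a set). (3::real))"
      by (intro prod.cong) (auto simp: inner_simps)
    then show ?thesis
      by (simp add: Q_def emeasure_lborel_cbox_eq inner_simps ennreal_3_power)
  qed
  have fin: "emeasure lborel R < \<infinity>" "emeasure lborel S < \<infinity>"
    using emeasure_mono[OF R, of lborel] emeasure_mono[OF S, of lborel]
      emeasure_lborel_cbox_finite[of 0 "One::'a"] emeasure_lborel_cbox_finite[of "-One" "One::'a"]
    by (auto intro: le_less_trans)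
  have emR: "emeasure lborel {x\<in>R. x - h \<in> S} = ennreal (measure lborel {x\<in>R. x - h \<in> S})" for h
    using fin emeasure_mono[of "{x\<in>R. x - h \<in> S}" R lborel]
    by (intro emeasure_eq_ennreal_measure) (auto simp: top_unique)
  have refl: "(\<integral>\<^sup>+h. indicator S (x - h) \<partial>lborel) = emeasure lborel S" for x :: 'a
  proof -
    have [measurable]: "S \<in> sets lebesgue" by simp
    have "(\<integral>\<^sup>+h. indicator S (x + (-1) *\<^sub>R h) \<partial>lebesgue) = (\<integral>\<^sup>+h. indicator S h \<partial>(lebesgue :: 'a measure) :: ennreal)"
      using nn_integral_lebesgue_affine[of "indicator S" "-1" x] by simp
    then show ?thesis by (simp add: nn_integral_completion)
  qed
  have slice: "(\<integral>\<^sup>+x. indicator R x * indicator S (x - h) \<partial>lborel) = emeasure lborel {x\<in>R. x - h \<in> S}" for h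
  proof -
    have "(\<integral>\<^sup>+x. indicator R x * indicator S (x - h) \<partial>lborel)
        = (\<integral>\<^sup>+x. indicator {x\<in>R. x - h \<in> S} x \<partial>lborel)"
      by (intro nn_integral_cong) (auto split: split_indicator)
    then show ?thesis by simp
  qed
  have "ennreal p = (\<integral>\<^sup>+x. indicator R x * emeasure lborel S \<partial>lborel)"
    using fin by (subst nn_integral_multc)
       (auto simp: p_def ennreal_mult'' emeasure_eq_ennreal_measure top_unique)
  also have "\<dots> = (\<integral>\<^sup>+x. (\<integral>\<^sup>+h. indicator R x * indicator S (x - h) \<partial>lborel) \<partial>lborel)"
    by (subst nn_integral_cmult) (auto simp: refl)
  also have "\<dots> = (\<integral>\<^sup>+h. (\<integral>\<^sup>+x. indicator R x * indicator S (x - h) \<partial>lborel) \<partial>lborel)"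
    by (rule lborel_pair.Fubini'[symmetric]) (auto simp: case_prod_beta')
  also have "\<dots> = (\<integral>\<^sup>+h. indicator Q h * emeasure lborel {x\<in>R. x - h \<in> S} \<partial>lborel)"
  proof (intro nn_integral_cong)
    fix h :: 'a
    have "emeasure lborel {x\<in>R. x - h \<in> S} = 0" if "h \<notin> Q"
    proof -
      have "{x\<in>R. x - h \<in> S} = {}"
      proof (rule ccontr)
        assume "{x\<in>R. x - h \<in> S} \<noteq> {}"
        then obtain x where "x \<in> cbox 0 One" "x - h \<in> cbox (-One) One" using R S by auto
        then have "h \<in> Q" unfolding Q_def cbox_def
          by (auto simp: inner_simps) force+
        then show False using that by simp
      qed
      then show ?thesis by (metis emeasure_empty)
    qed
    then show "(\<integral>\<^sup>+x. indicator R x * indicator S (x - h) \<partial>lborel) = indicator Q h * emeasure lborel {x\<in>R. x - h \<in> S}"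
      by (auto simp: slice split: split_indicator)
  qed
  finally have eq: "ennreal p = (\<integral>\<^sup>+h. indicator Q h * emeasure lborel {x\<in>R. x - h \<in> S} \<partial>lborel)" .
  have "(\<integral>\<^sup>+h. indicator Q h * emeasure lborel {x\<in>R. x - h \<in> S} \<partial>lborel)
      < (\<integral>\<^sup>+h. ennreal (p / 3 ^ DIM('a)) * indicator Q h \<partial>lborel)"
  proof (rule nn_integral_less)
    show "(\<lambda>h. indicator Q h * emeasure lborel {x\<in>R. x - h \<in> S}) \<in> borel_measurable lborel"
    proof -
      have "(\<lambda>h. \<integral>\<^sup>+x. indicator R x * indicator S (x - h) \<partial>lborel) \<in> borel_measurable (lborel :: 'a measure)"
        by measurable
      then show ?thesis by (simp add: slice)
    qed
    show "(\<integral>\<^sup>+h. indicator Q h * emeasure lborel {x\<in>R. x - h \<in> S} \<partial>lborel) \<noteq> \<infinity>"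
      using eq[symmetric] by simp
    show "AE h in lborel. indicator Q h * emeasure lborel {x\<in>R. x - h \<in> S} \<le> ennreal (p / 3 ^ DIM('a)) * indicator Q h"
      using less_imp_le[OF less] by (auto simp: emR p_def field_simps intro!: ennreal_leI split: split_indicator)
    \<comment> \<open>The assumed inequality is strict at every point of \<open>Q\<close>, and
      \<open>Q\<close> has positive measure, so strictness survives integration.\<close>
    show "\<not> (AE h in lborel. ennreal (p / 3 ^ DIM('a)) * indicator Q h \<le> indicator Q h * emeasure lborel {x\<in>R. x - h \<in> S})"
    proof
      assume "AE h in lborel. ennreal (p / 3 ^ DIM('a)) * indicator Q h \<le> indicator Q h * emeasure lborel {x\<in>R. x - h \<in> S}"
      then have "AE h in lborel. h \<notin> Q"
      proof eventually_elim
        case (elim h)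
        show ?case
        proof
          assume "h \<in> Q"
          then have "p / 3 ^ DIM('a) \<le> measure lborel {x\<in>R. x - h \<in> S}"
            using elim by (simp add: emR)
          then show False using less[of h] by (simp add: p_def field_simps)
        qed
      qed
      then have "emeasure lborel Q = 0" by (subst (asm) AE_iff_null) (auto)
      then show False using Q by simp
    qed
  qed simp
  also have "\<dots> = ennreal p"
    by (simp add: nn_integral_cmult Q ennreal_3_power p_def ennreal_mult[symmetric])
  finally show False using eq by simp
qed

lemma emeasure_unit_cbox: "emeasure lborel (cbox 0 (One::'a::euclidean_space)) = 1"
  by (simp add: emeasure_lborel_cbox_eq)

lemma measure_unit_cbox: "measure lborel (cbox 0 (One::'a::euclidean_space)) = 1"
  by (simp add: measure_def emeasure_unit_cbox)

lemma emeasure_symmetric_cbox_le: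
  "emeasure lborel (cbox (-One) (One::'a::euclidean_space)) \<le> ennreal (3 ^ DIM('a))"
proof -
  have "(\<Prod>b\<in>(Basis::'a set). (One - - One) \<bullet> b) = (\<Prod>b\<in>(Basis::'a set). (2::real))"
    by (intro prod.cong) (auto simp: inner_simps)
  also have "\<dots> \<le> (\<Prod>b\<in>(Basis::'a set). 3)"
    by (intro prod_mono) auto
  finally show ?thesis
    by (simp add: emeasure_lborel_cbox_eq inner_simps ennreal_leI)
qed

text \<open>Greedy choice: as long as more than half of the cube is uncovered,
  \<open>exists_translate_overlap\<close>, applied to the uncovered part, yields a translate that
  removes at least |S| / (2 * 3^n) from it. The maximum with 1/2 lets the induction continue once
  half is covered, when no further gain is required.\<close>

lemma unit_cube_cover:
  fixes S :: "'a::euclidean_space set"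
  assumes [measurable]: "S \<in> sets borel" and S: "S \<subseteq> cbox (-One) One"
  shows "\<exists>h :: nat \<Rightarrow> 'a. measure lborel (cbox 0 One - (\<Union>i<N. {x. x - h i \<in> S}))
           \<le> max (1/2) (1 - N * measure lborel S / (2 * 3 ^ DIM('a)))"
proof (induction N)
  case 0
  then show ?case using measure_unit_cbox[where 'a='a] by simp
next
  case (Suc N)
  then obtain h :: "nat \<Rightarrow> 'a" where
    h: "measure lborel (cbox 0 One - (\<Union>i<N. {x. x - h i \<in> S})) \<le> max (1/2) (1 - N * measure lborel S / (2 * 3 ^ DIM('a)))"
    by blast
  define R where "R = cbox 0 One - (\<Union>i<N. {x. x - h i \<in> S})"
  have [measurable]: "R \<in> sets borel" unfolding R_def by measurable
  have R: "R \<subseteq> cbox 0 One" by (auto simp: R_def)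
  obtain k where k: "measure lborel R * measure lborel S \<le> 3 ^ DIM('a) * measure lborel {x\<in>R. x - k \<in> S}"
    using exists_translate_overlap[OF _ _ R S] by auto
  have fin: "emeasure lborel R \<noteq> \<infinity>"
    using emeasure_mono[OF R, of lborel] emeasure_lborel_cbox_finite[of 0 "One::'a"]
    by (auto simp: top_unique)
  have "cbox 0 One - (\<Union>i<Suc N. {x. x - (h(N := k)) i \<in> S}) = R - {x\<in>R. x - k \<in> S}"
    by (auto simp: R_def less_Suc_eq)
  then have eq: "measure lborel (cbox 0 One - (\<Union>i<Suc N. {x. x - (h(N := k)) i \<in> S}))
      = measure lborel R - measure lborel {x\<in>R. x - k \<in> S}"
    using fin by (simp add: measure_Diff)
  show ?case
  proof (rule exI[of _ "h(N := k)"], unfold eq, cases "measure lborel R \<le> 1/2")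
    case True
    then show "measure lborel R - measure lborel {x\<in>R. x - k \<in> S}
      \<le> max (1/2) (1 - real (Suc N) * measure lborel S / (2 * 3 ^ DIM('a)))"
      using measure_nonneg[of lborel "{x\<in>R. x - k \<in> S}"] by linarith
  next
    case False
    then have "measure lborel R \<le> 1 - N * measure lborel S / (2 * 3 ^ DIM('a))"
      using h by (auto simp: R_def)
    moreover have "1/2 * measure lborel S \<le> 3 ^ DIM('a) * measure lborel {x\<in>R. x - k \<in> S}"
      by (rule order_trans[OF mult_right_mono k]) (use False in auto)
    then have "measure lborel S / (2 * 3 ^ DIM('a)) \<le> measure lborel {x\<in>R. x - k \<in> S}"
      by (simp add: field_simps)
    moreover have "real (Suc N) * measure lborel S / (2 * 3 ^ DIM('a))
        = N * measure lborel S / (2 * 3 ^ DIM('a)) + measure lborel S / (2 * 3 ^ DIM('a))"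
      by (simp add: add_divide_distrib distrib_right)
    ultimately show "measure lborel R - measure lborel {x\<in>R. x - k \<in> S}
      \<le> max (1/2) (1 - real (Suc N) * measure lborel S / (2 * 3 ^ DIM('a)))"
      by linarith
  qed
qed

section \<open>Functions \<open>\<Phi>\<close> for which \<open>\<Phi> (sqrt t)\<close> is
  concave\<close>

locale sqrt_concave =
  fixes \<Phi> :: "real \<Rightarrow> real"
  assumes nonneg: "t \<ge> 0 \<Longrightarrow> \<Phi> t \<ge> 0"
    and continuous: "continuous_on {0..} \<Phi>"
    and mono: "mono_on {0..} \<Phi>"
    and zero: "\<Phi> 0 = 0"
    and concave: "concave_on {0..} (\<lambda>t. \<Phi> (sqrt t))"
    and unbounded: "filterlim \<Phi> at_top at_top"
begin

lemma mono': "0 \<le> s \<Longrightarrow> s \<le> t \<Longrightarrow> \<Phi> s \<le> \<Phi> t"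
  using mono by (auto simp: mono_on_def)

text \<open>Concavity on the segment from 0 to s, at whose left end the function vanishes.\<close>

lemma sqrt_scale_le: "0 \<le> s \<Longrightarrow> 0 \<le> u \<Longrightarrow> u \<le> 1 \<Longrightarrow> u * \<Phi> (sqrt s) \<le> \<Phi> (sqrt (u * s))"
  using concave_onD[OF concave, of u 0 s] by (simp add: zero)

text \<open>For c > 1 this is \<open>sqrt_scale_le\<close> with factor 1 / c^2 at the point (c t)^2;
  otherwise monotonicity suffices. Growth is thus at most quadratic, which makes the class closed
  under scalar multiplication.\<close>

lemma scale_le:
  assumes "c \<ge> 0" "t \<ge> 0"
  shows "\<Phi> (c * t) \<le> max 1 (c\<^sup>2) * \<Phi> t"
proof (cases "c \<le> 1")
  case True
  then have "\<Phi> (c * t) \<le> 1 * \<Phi> t"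
    using assms by (simp add: mono' mult_left_le_one_le)
  also have "\<dots> \<le> max 1 (c\<^sup>2) * \<Phi> t"
    using assms nonneg by (intro mult_right_mono) auto
  finally show ?thesis .
next
  case False
  then have "(1 / c\<^sup>2) * \<Phi> (sqrt (c\<^sup>2 * t\<^sup>2)) \<le> \<Phi> (sqrt ((1 / c\<^sup>2) * (c\<^sup>2 * t\<^sup>2)))"
    by (intro sqrt_scale_le) auto
  then have "\<Phi> (c * t) \<le> c\<^sup>2 * \<Phi> t"
    using False assms by (simp add: real_sqrt_mult divide_simps mult.commute split: if_splits)
  also have "\<dots> \<le> max 1 (c\<^sup>2) * \<Phi> t"
    using assms nonneg by (intro mult_right_mono) auto
  finally show ?thesis .
qed

text \<open>A concave function vanishing at 0 is subadditive: \<open>sqrt_scale_le\<close> is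
  applied with the weights p / (p + q) and q / (p + q), which add up to 1.\<close>

lemma sqrt_subadd:
  assumes "0 \<le> p" "0 \<le> q"
  shows "\<Phi> (sqrt (p + q)) \<le> \<Phi> (sqrt p) + \<Phi> (sqrt q)"
proof (cases "p + q = 0")
  case True
  then show ?thesis using assms by (simp add: zero add_nonneg_eq_0_iff)
next
  case False
  then have "p / (p + q) * \<Phi> (sqrt (p + q)) \<le> \<Phi> (sqrt p)" "q / (p + q) * \<Phi> (sqrt (p + q)) \<le> \<Phi> (sqrt q)"
    using assms sqrt_scale_le[of "p + q" "p / (p + q)"] sqrt_scale_le[of "p + q" "q / (p + q)"] by auto
  moreover have "p / (p + q) * \<Phi> (sqrt (p + q)) + q / (p + q) * \<Phi> (sqrt (p + q)) = \<Phi> (sqrt (p + q))"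
    using False by (simp flip: distrib_right add_divide_distrib)
  ultimately show ?thesis by linarith
qed

text \<open>By the parallelogram law the mean of |u + v|^2 and |u - v|^2 is |u|^2 + |v|^2. Midpoint
  concavity of \<open>\<Phi> (sqrt t)\<close> and \<open>sqrt_subadd\<close> then give the bound,
  which is the inductive step of \<open>sum_signs_le\<close>.\<close>

lemma parallelogram:
  fixes u v :: "'b::real_inner"
  shows "\<Phi> (norm (u + v)) + \<Phi> (norm (u - v)) \<le> 2 * \<Phi> (norm u) + 2 * \<Phi> (norm v)"
proof -
  define a b where "a = (norm (u + v))\<^sup>2" and "b = (norm (u - v))\<^sup>2"
  have ab: "(1 - 1/2) * a + (1/2) * b = (norm u)\<^sup>2 + (norm v)\<^sup>2"
    by (simp add: a_def b_def power2_norm_eq_inner inner_add inner_diff algebra_simps)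
  have "(1 - 1/2) * \<Phi> (sqrt a) + (1/2) * \<Phi> (sqrt b) \<le> \<Phi> (sqrt ((1 - 1/2) * a + (1/2) * b))"
    using concave_onD[OF concave, of "1/2" a b] by (simp add: a_def b_def)
  also have "\<dots> \<le> \<Phi> (norm u) + \<Phi> (norm v)"
    unfolding ab using sqrt_subadd[of "(norm u)\<^sup>2" "(norm v)\<^sup>2"] by simp
  finally show ?thesis by (simp add: a_def b_def)
qed

lemma add_le:
  fixes u v :: "'b::real_inner"
  shows "\<Phi> (norm (u + v)) \<le> 2 * \<Phi> (norm u) + 2 * \<Phi> (norm v)"
  using parallelogram[of u v] nonneg[of "norm (u - v)"] by simp

text \<open>By \<open>scale_le\<close>, a zero at some t > 0 would force zeros at all positive
  multiples of t, contradicting unboundedness.\<close>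

lemma pos:
  assumes "t > 0"
  shows "\<Phi> t > 0"
proof (rule ccontr)
  assume "\<not> \<Phi> t > 0"
  then have 0: "\<Phi> t = 0" using nonneg[of t] assms by simp
  obtain N where N: "\<And>s. s \<ge> N \<Longrightarrow> \<Phi> s \<ge> 1"
    using unbounded by (auto simp: filterlim_at_top eventually_at_top_linorder)
  have "\<Phi> (max N t / t * t) \<le> max 1 ((max N t / t)\<^sup>2) * \<Phi> t"
    by (rule scale_le) (use assms in auto)
  then show False using N[of "max N t"] assms by (simp add: 0)
qed

section \<open>The class \<open>L_Phi\<close> and the normalisation of its members\<close>

lemma borel_measurable_Phi_norm [measurable]:
  fixes f :: "'a \<Rightarrow> 'b::real_normed_vector"
  assumes [measurable]: "f \<in> borel_measurable M"
  shows "(\<lambda>x. \<Phi> (norm (f x))) \<in> borel_measurable M"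
proof -
  \<comment> \<open>Continuity is known on the half-line only; composing with \<open>max 0\<close>
    gives a function continuous on the whole line that agrees with \<open>\<Phi>\<close> at
    norms.\<close>
  have "continuous_on UNIV (\<lambda>t. \<Phi> (max 0 t))"
    by (rule continuous_on_compose2[OF continuous]) (auto intro!: continuous_intros)
  then have [measurable]: "(\<lambda>t. \<Phi> (max 0 t)) \<in> borel_measurable borel"
    by (rule borel_measurable_continuous_onI)
  have "(\<lambda>x. (\<lambda>t. \<Phi> (max 0 t)) (norm (f x))) \<in> borel_measurable M"
    by measurable
  then show ?thesis by simp
qed

lemma Phi_norm_cmult_le:
  fixes f :: "('n::finite, 'b::real_normed_field) fn"
  assumes [measurable]: "f \<in> borel_measurable lebesgue"
  shows "Phi_norm \<Phi> (\<lambda>x. c * f x) \<le> ennreal (max 1 ((norm c)\<^sup>2)) * Phi_norm \<Phi> f"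
proof -
  have "Phi_norm \<Phi> (\<lambda>x. c * f x) \<le> (\<integral>\<^sup>+x. ennreal (max 1 ((norm c)\<^sup>2)) * ennreal (\<Phi> (norm (f x))) \<partial>lebesgue)"
    unfolding Phi_norm_def
    by (intro nn_integral_mono) (auto simp: norm_mult scale_le nonneg simp flip: ennreal_mult intro!: ennreal_leI)
  then show ?thesis unfolding Phi_norm_def by (subst (asm) nn_integral_cmult) auto
qed

lemma L_Phi_cmult:
  fixes f :: "('n::finite, 'b::{real_normed_field, euclidean_space}) fn"
  assumes "f \<in> L_Phi \<Phi>"
  shows "(\<lambda>x. c * f x) \<in> L_Phi \<Phi>"
proof -
  have [measurable]: "f \<in> borel_measurable lebesgue" using assms by (simp add: L_Phi_def)
  show ?thesis
    using assms Phi_norm_cmult_le[of f c]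
    by (auto simp: L_Phi_def ennreal_mult_less_top intro: le_less_trans)
qed

lemma L_Phi_add:
  fixes f g :: "('n::finite, 'b::euclidean_space) fn"
  assumes "f \<in> L_Phi \<Phi>" "g \<in> L_Phi \<Phi>"
  shows "(\<lambda>x. f x + g x) \<in> L_Phi \<Phi>"
proof -
  have [measurable]: "f \<in> borel_measurable lebesgue" "g \<in> borel_measurable lebesgue"
    using assms by (auto simp: L_Phi_def)
  have "Phi_norm \<Phi> (\<lambda>x. f x + g x) \<le> (\<integral>\<^sup>+x. 2 * ennreal (\<Phi> (norm (f x))) + 2 * ennreal (\<Phi> (norm (g x))) \<partial>lebesgue)"
    unfolding Phi_norm_def
  proof (intro nn_integral_mono)
    fix x
    have "ennreal (\<Phi> (norm (f x + g x))) \<le> ennreal (2 * \<Phi> (norm (f x)) + 2 * \<Phi> (norm (g x)))"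
      by (intro ennreal_leI add_le)
    also have "\<dots> = 2 * ennreal (\<Phi> (norm (f x))) + 2 * ennreal (\<Phi> (norm (g x)))"
      by (simp add: nonneg ennreal_mult)
    finally show "ennreal (\<Phi> (norm (f x + g x))) \<le> 2 * ennreal (\<Phi> (norm (f x))) + 2 * ennreal (\<Phi> (norm (g x)))" .
  qed
  also have "\<dots> = 2 * Phi_norm \<Phi> f + 2 * Phi_norm \<Phi> g"
    unfolding Phi_norm_def by (simp add: nn_integral_add nn_integral_cmult)
  also have "\<dots> < \<infinity>"
    using assms by (simp add: L_Phi_def ennreal_mult_less_top)
  finally show ?thesis by (simp add: L_Phi_def)
qed

lemma L_Phi_sum:
  fixes f :: "'i \<Rightarrow> ('n::finite, 'b::euclidean_space) fn"
  assumes "finite I" "\<And>i. i \<in> I \<Longrightarrow> f i \<in> L_Phi \<Phi>"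
  shows "(\<lambda>x. \<Sum>i\<in>I. f i x) \<in> L_Phi \<Phi>"
  using assms
proof (induction rule: finite_induct)
  case empty
  then show ?case by (simp add: L_Phi_def Phi_norm_def zero)
qed (simp add: L_Phi_add)

lemma Phi_norm_eq_0:
  fixes f :: "('n::finite, 'b::real_normed_vector) fn"
  assumes [measurable]: "f \<in> borel_measurable lebesgue"
  shows "Phi_norm \<Phi> f = 0 \<longleftrightarrow> (AE x in lebesgue. f x = 0)"
proof -
  have "ennreal (\<Phi> (norm y)) = 0 \<longleftrightarrow> y = 0" for y :: 'b
    using pos[of "norm y"] by (cases "y = 0") (auto simp: zero)
  then show ?thesis
    unfolding Phi_norm_def by (subst nn_integral_0_iff_AE) auto
qed

text \<open>A function that is not almost everywhere 0 exceeds some \<delta> > 0 in norm on a set D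
  of positive measure. Since \<open>\<Phi>\<close> is unbounded, a large s makes
  \<open>\<Phi> (s * \<delta>)\<close> outweigh the possibly small measure of D.\<close>

lemma Phi_norm_scale_ge_1:
  fixes f :: "('n::finite, 'b::real_normed_field) fn"
  assumes [measurable]: "f \<in> borel_measurable lebesgue" and "Phi_norm \<Phi> f \<noteq> 0"
  shows "\<exists>s\<ge>1. 1 \<le> Phi_norm \<Phi> (\<lambda>x. of_real s * f x)"
proof -
  have "\<not> (AE x in lebesgue. \<forall>k::nat. norm (f x) \<le> 1 / Suc k)"
  proof
    assume "AE x in lebesgue. \<forall>k::nat. norm (f x) \<le> 1 / Suc k"
    then have "AE x in lebesgue. f x = 0"
    proof eventually_elim
      case (elim x)
      show ?case
      proof (rule ccontr)
        assume "f x \<noteq> 0"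
        then obtain k where "inverse (Suc k) < norm (f x)"
          using reals_Archimedean[of "norm (f x)"] by auto
        then show False using elim[rule_format, of k] by (simp add: inverse_eq_divide)
      qed
    qed
    then show False using assms by (simp add: Phi_norm_eq_0)
  qed
  then obtain k :: nat where k: "\<not> (AE x in lebesgue. norm (f x) \<le> 1 / Suc k)"
    by (auto simp: AE_all_countable)
  define \<delta> where "\<delta> = 1 / real (Suc k)"
  define D where "D = {x. norm (f x) > \<delta>}"
  have \<delta>: "\<delta> > 0" by (simp add: \<delta>_def)
  have [measurable]: "D \<in> sets lebesgue"
    using measurable_sets[of "\<lambda>x. norm (f x)" lebesgue borel "{\<delta><..}"] by (simp add: D_def vimage_def)
  have "emeasure lebesgue D \<noteq> 0"
  proof
    assume "emeasure lebesgue D = 0"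
    then have "AE x in lebesgue. x \<notin> D"
      by (intro AE_not_in) (auto simp: null_sets_def)
    then show False using k by (simp add: D_def \<delta>_def not_less)
  qed
  \<comment> \<open>\<open>D\<close> may have infinite measure, so a finite positive lower bound
    takes the place of its measure.\<close>
  then obtain m where m: "m > 0" "ennreal m \<le> emeasure lebesgue D"
    by (cases "emeasure lebesgue D = top")
       (auto simp: enn2real_positive_iff less_top zero_less_iff_neq_zero
         intro: that[of 1] that[of "enn2real (emeasure lebesgue D)"] simp del: emeasure_completion)
  have "eventually (\<lambda>s. \<Phi> s \<ge> 1 / m) at_top"
    using unbounded by (simp add: filterlim_at_top)
  then obtain N where N: "\<And>s. s \<ge> N \<Longrightarrow> \<Phi> s \<ge> 1 / m"
    by (auto simp: eventually_at_top_linorder)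
  define s where "s = max 1 (N / \<delta>)"
  have s: "s \<ge> 1" "s * \<delta> \<ge> N" using \<delta> by (auto simp: s_def max_def field_simps)
  have "1 = ennreal (1 / m) * ennreal m"
    using m by (simp flip: ennreal_mult)
  also have "\<dots> \<le> ennreal (\<Phi> (s * \<delta>)) * emeasure lebesgue D"
    by (intro mult_mono ennreal_leI N s m) auto
  also have "\<dots> = (\<integral>\<^sup>+x. ennreal (\<Phi> (s * \<delta>)) * indicator D x \<partial>lebesgue)"
    by (simp add: nn_integral_cmult)
  also have "\<dots> \<le> Phi_norm \<Phi> (\<lambda>x. of_real s * f x)"
    unfolding Phi_norm_def using s \<delta>
    by (intro nn_integral_mono)
       (auto simp: norm_mult D_def split: split_indicator intro!: ennreal_leI mono' mult_mono mult_nonneg_nonneg)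
  finally show ?thesis using s by blast
qed

text \<open>\<open>Phi_norm\<close> is not homogeneous, so dividing by it does not normalise f.
  Instead the intermediate value theorem is applied to the scaling parameter, between the scale 1
  and the scale given by \<open>Phi_norm_scale_ge_1\<close>.\<close>

lemma Phi_norm_scale_eq_1:
  fixes f :: "('n::finite, 'b::{real_normed_field, euclidean_space}) fn"
  assumes f: "f \<in> L_Phi \<Phi>" and "Phi_norm \<Phi> f \<noteq> 0" "Phi_norm \<Phi> f \<le> 1"
  shows "\<exists>s\<ge>1. Phi_norm \<Phi> (\<lambda>x. of_real s * f x) = 1"
proof -
  have [measurable]: "f \<in> borel_measurable lebesgue" using f by (simp add: L_Phi_def)
  obtain r where r: "r \<ge> 1" "1 \<le> Phi_norm \<Phi> (\<lambda>x. of_real r * f x)"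
    using Phi_norm_scale_ge_1[of f] assms by auto
  \<comment> \<open>With the parameter under the root, the integrand at x is
    \<open>\<Phi> (sqrt t)\<close> evaluated at t = s |f x|^2, so \<open>p\<close> inherits
    concavity.\<close>
  define p where "p s = (LINT x|lebesgue. \<Phi> (sqrt s * norm (f x)))" for s
  have norm_eq: "norm ((of_real (sqrt s) :: 'b) * f x) = sqrt s * norm (f x)" if "s \<ge> 0" for s x
    using that by (simp add: norm_mult)
  have int: "integrable lebesgue (\<lambda>x. \<Phi> (sqrt s * norm (f x)))" if "s \<ge> 0" for s
  proof -
    have "integrable lebesgue (\<lambda>x. \<Phi> (norm ((of_real (sqrt s) :: 'b) * f x)))"
      using L_Phi_cmult[OF f, of "of_real (sqrt s)"]
      by (intro integrableI_nonneg) (auto simp: L_Phi_def Phi_norm_def nonneg)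
    then show ?thesis by (simp only: norm_eq[OF that])
  qed
  have Phi_norm_eq: "Phi_norm \<Phi> (\<lambda>x. of_real (sqrt s) * f x) = ennreal (p s)" if "s \<ge> 0" for s
    unfolding Phi_norm_def norm_eq[OF that] p_def
    using int[OF that] that by (subst nn_integral_eq_integral) (auto simp: nonneg)
  have "concave_on {0<..} p"
    unfolding concave_on_iff
  proof (intro conjI ballI allI impI)
    fix s t u v :: real
    assume *: "s \<in> {0<..}" "t \<in> {0<..}" "0 \<le> u" "0 \<le> v" "u + v = 1"
    have "u * p s + v * p t = (LINT x|lebesgue. u * \<Phi> (sqrt s * norm (f x)) + v * \<Phi> (sqrt t * norm (f x)))"
      unfolding p_def using * by (subst Bochner_Integration.integral_add) (auto intro!: integrable_mult_right int)
    also have "\<dots> \<le> p (u *\<^sub>R s + v *\<^sub>R t)"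
      unfolding p_def
    proof (rule integral_mono)
      show "integrable lebesgue (\<lambda>x. u * \<Phi> (sqrt s * norm (f x)) + v * \<Phi> (sqrt t * norm (f x)))"
        using * by (intro Bochner_Integration.integrable_add integrable_mult_right int) auto
      show "integrable lebesgue (\<lambda>x. \<Phi> (sqrt (u *\<^sub>R s + v *\<^sub>R t) * norm (f x)))"
        using * by (intro int) auto
      fix x
      have "u * \<Phi> (sqrt (s * (norm (f x))\<^sup>2)) + v * \<Phi> (sqrt (t * (norm (f x))\<^sup>2))
          \<le> \<Phi> (sqrt (u *\<^sub>R (s * (norm (f x))\<^sup>2) + v *\<^sub>R (t * (norm (f x))\<^sup>2)))"
        using concave[unfolded concave_on_iff] * by auto
      also have "u *\<^sub>R (s * (norm (f x))\<^sup>2) + v *\<^sub>R (t * (norm (f x))\<^sup>2) = (u *\<^sub>R s + v *\<^sub>R t) * (norm (f x))\<^sup>2"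
        by (simp add: algebra_simps)
      finally show "u * \<Phi> (sqrt s * norm (f x)) + v * \<Phi> (sqrt t * norm (f x)) \<le> \<Phi> (sqrt (u *\<^sub>R s + v *\<^sub>R t) * norm (f x))"
        by (simp add: real_sqrt_mult)
    qed
    finally show "u * p s + v * p t \<le> p (u *\<^sub>R s + v *\<^sub>R t)" .
  qed simp
  \<comment> \<open>Continuity comes for free: a finite convex function is continuous on an open
    interval.\<close>
  then have "continuous_on {0<..} (\<lambda>s. - p s)"
    unfolding concave_on_def by (intro convex_on_continuous) auto
  then have "continuous_on {0<..} p"
    using continuous_on_minus by fastforce
  then have cont: "continuous_on {1..r\<^sup>2} p"
    by (rule continuous_on_subset) auto
  have "p 1 \<le> 1"
    using Phi_norm_eq[of 1] assms by simp
  moreover have "1 \<le> p (r\<^sup>2)"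
    using Phi_norm_eq[of "r\<^sup>2"] r by simp
  moreover have "1 \<le> r\<^sup>2" using r by simp
  ultimately obtain s where s: "1 \<le> s" "p s = 1"
    using IVT'[of p 1 1 "r\<^sup>2"] cont by auto
  then show ?thesis
    using Phi_norm_eq[of s] by (intro exI[of _ "sqrt s"]) auto
qed

text \<open>The intermediate value theorem gives t with \<open>\<Phi> t = 1\<close>, and the cube
  carrying the value t has measure 1. Such a function is the base of the perturbation in
  \<open>level_null\<close>.\<close>

lemma exists_Phi_norm_eq_1: "\<exists>g\<in>L_Phi \<Phi>. Phi_norm \<Phi> (g :: ('n::finite, 'b::{real_normed_field, euclidean_space}) fn) = 1"
proof -
  obtain N where N: "\<And>s. s \<ge> N \<Longrightarrow> \<Phi> s \<ge> 1"
    using unbounded by (auto simp: filterlim_at_top eventually_at_top_linorder)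
  have "\<exists>t. 0 \<le> t \<and> t \<le> max 0 N \<and> \<Phi> t = 1"
    using N[of "max 0 N"] zero continuous_on_subset[OF continuous, of "{0..max 0 N}"] by (intro IVT') auto
  then obtain t where t: "t \<ge> 0" "\<Phi> t = 1" by auto
  define g :: "('n, 'b) fn" where "g x = (if x \<in> cbox 0 One then of_real t else 0)" for x
  have "g \<in> borel_measurable lborel" unfolding g_def by measurable
  then have [measurable]: "g \<in> borel_measurable lebesgue" by (rule measurable_completion)
  have "Phi_norm \<Phi> g = (\<integral>\<^sup>+x. indicator (cbox 0 One) x \<partial>(lebesgue :: (real^'n) measure))"
    unfolding Phi_norm_def by (intro nn_integral_cong) (auto simp: g_def t zero split: split_indicator)
  also have "\<dots> = 1"
    by (simp add: emeasure_unit_cbox)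
  finally show ?thesis by (intro bexI[of _ g]) (auto simp: L_Phi_def)
qed

text \<open>A choice of signs is encoded as the set A of indices with sign plus, so the sum over
  \<open>Pow {..<N}\<close> is 2^N times the average over all choices. In the induction, A and
  \<open>insert N A\<close> differ only in the last sign, and \<open>parallelogram\<close> bounds
  the two terms together.\<close>

lemma sum_signs_le:
  fixes u :: "nat \<Rightarrow> 'b::real_inner"
  shows "(\<Sum>A\<in>Pow {..<N}. \<Phi> (norm (\<Sum>i<N. if i \<in> A then u i else - u i))) \<le> 2 ^ N * (\<Sum>i<N. \<Phi> (norm (u i)))"
proof (induction N)
  case 0
  then show ?case by (simp add: zero)
next
  case (Suc N)
  define F where "F A = (\<Sum>i<N. if i \<in> A then u i else - u i)" for A
  have F_insert: "F (insert N A) = F A" for A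
    unfolding F_def by (intro sum.cong) auto
  have inj: "inj_on (insert N) (Pow {..<N})"
    by (force simp: inj_on_def)
  have "(\<Sum>A\<in>Pow {..<Suc N}. \<Phi> (norm (\<Sum>i<Suc N. if i \<in> A then u i else - u i)))
      = (\<Sum>A\<in>Pow {..<N} \<union> insert N ` Pow {..<N}. \<Phi> (norm (F A + (if N \<in> A then u N else - u N))))"
    by (simp add: lessThan_Suc Pow_insert F_def add.commute)
  also have "\<dots> = (\<Sum>A\<in>Pow {..<N}. \<Phi> (norm (F A - u N))) + (\<Sum>A\<in>Pow {..<N}. \<Phi> (norm (F A + u N)))"
    by (subst sum.union_disjoint)
       (auto simp: sum.reindex[OF inj] F_insert intro!: arg_cong2[of _ _ _ _ "(+)"] sum.cong)
  also have "\<dots> \<le> (\<Sum>A\<in>Pow {..<N}. 2 * \<Phi> (norm (F A)) + 2 * \<Phi> (norm (u N)))"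
    unfolding sum.distrib[symmetric] using parallelogram by (intro sum_mono) (simp add: add.commute)
  also have "\<dots> = 2 * (\<Sum>A\<in>Pow {..<N}. \<Phi> (norm (F A))) + 2 ^ Suc N * \<Phi> (norm (u N))"
    by (simp add: sum.distrib sum_distrib_left card_Pow)
  also have "\<dots> \<le> 2 * (2 ^ N * (\<Sum>i<N. \<Phi> (norm (u i)))) + 2 ^ Suc N * \<Phi> (norm (u N))"
    using Suc.IH unfolding F_def by simp
  also have "\<dots> = 2 ^ Suc N * (\<Sum>i<Suc N. \<Phi> (norm (u i)))"
    by (simp add: algebra_simps)
  finally show ?case .
qed

end

section \<open>Invariant sublinear operators and their level sets\<close>

declare emeasure_completion [simp del]

locale invariant_operator = sqrt_concave \<Phi> for \<Phi> +
  fixes T :: "('n::finite, 'b::{real_normed_field, euclidean_space}) fn \<Rightarrow> ('n, 'b) fn"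
  assumes T_measurable: "f \<in> L_Phi \<Phi> \<Longrightarrow> T f \<in> borel_measurable lebesgue"
    and sublinear: "sublinear_on (L_Phi \<Phi>) T"
    and cont: "continuous_in_measure \<Phi> T"
    and translation: "translation_invariant_on (L_Phi \<Phi>) T"
    and dilation: "dilation_invariant_on (L_Phi \<Phi>) T"
begin

lemma T_add_le:
  assumes "f \<in> L_Phi \<Phi>" "g \<in> L_Phi \<Phi>"
  shows "AE x in lebesgue. norm (T (\<lambda>y. f y + g y) x) \<le> norm (T f x) + norm (T g x)"
  using sublinear assms by (auto simp: sublinear_on_def)

lemma T_cmult:
  assumes "f \<in> L_Phi \<Phi>"
  shows "AE x in lebesgue. norm (T (\<lambda>y. c * f y) x) = norm c * norm (T f x)"
  using sublinear assms by (auto simp: sublinear_on_def)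

lemma T_diff_le:
  assumes f: "f \<in> L_Phi \<Phi>" and g: "g \<in> L_Phi \<Phi>"
  shows "AE x in lebesgue. norm (T (\<lambda>y. f y - g y) x) \<le> norm (T f x) + norm (T g x)"
  using T_add_le[OF f L_Phi_cmult[OF g, of "-1"]] T_cmult[OF g, of "-1"]
  by eventually_elim simp

definition level :: "('n, 'b) fn \<Rightarrow> real \<Rightarrow> (real^'n) set" where
  "level f l = {x. norm (T f x) > l}"

lemma sets_level [measurable]:
  assumes "f \<in> L_Phi \<Phi>"
  shows "level f l \<in> sets lebesgue"
proof -
  note [measurable] = T_measurable[OF assms]
  have "(\<lambda>x. norm (T f x)) -` {l<..} \<inter> space lebesgue \<in> sets lebesgue"
    by measurable
  then show ?thesis by (simp add: level_def vimage_def)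
qed

section \<open>Estimates for a single function in the unit cube\<close>

definition unit_cube :: "(real^'n) set" where
  "unit_cube = cbox 0 One"

lemma sets_unit_cube [measurable]: "unit_cube \<in> sets lebesgue"
  by (simp add: unit_cube_def)

lemma emeasure_unit_cube: "emeasure lebesgue unit_cube = 1"
  by (simp add: unit_cube_def emeasure_completion emeasure_unit_cbox)

lemma emeasure_unit_cube_le: "emeasure lebesgue (unit_cube \<inter> A) \<le> 1"
  using emeasure_mono[of "unit_cube \<inter> A" unit_cube lebesgue] emeasure_unit_cube by simp

text \<open>Continuity in measure is used for the unit cube only; other positions and scales are
  reached later by translations and dilations. As the bound C tends to 0, a single threshold serves
  all functions of norm 1.\<close>

lemma level_small:
  assumes "e > 0"
  shows "\<exists>l>0. \<forall>f\<in>L_Phi \<Phi>. Phi_norm \<Phi> f = 1 \<longrightarrow> emeasure lebesgue (unit_cube \<inter> level f l) \<le> ennreal e"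
proof -
  have "emeasure lebesgue unit_cube < \<infinity>"
    by (simp add: emeasure_unit_cube)
  from cont[unfolded continuous_in_measure_def, rule_format, OF sets_unit_cube this]
  obtain C :: "real \<Rightarrow> real" where C: "(C \<longlongrightarrow> 0) at_top"
    "\<And>l f. l > 0 \<Longrightarrow> f \<in> L_Phi \<Phi> \<Longrightarrow> Phi_norm \<Phi> f = 1 \<Longrightarrow>
       emeasure lebesgue {x \<in> unit_cube. norm (T f x) > l} \<le> ennreal (C l)"
    by blast
  have "eventually (\<lambda>l. C l < e \<and> l > 0) at_top"
    using order_tendstoD(2)[OF C(1) assms] eventually_gt_at_top[of 0] by eventually_elim simp
  then obtain l where "C l < e" "l > 0"
    using eventually_happens'[OF trivial_limit_at_top_linorder] by blast
  moreover have "unit_cube \<inter> level f l = {x \<in> unit_cube. norm (T f x) > l}" for f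
    by (auto simp: level_def)
  moreover have "ennreal (C l) \<le> ennreal e"
    using \<open>C l < e\<close> by (intro ennreal_leI) simp
  ultimately show ?thesis
    using order_trans[OF C(2)[OF \<open>l > 0\<close>]] by auto
qed

text \<open>
  \<open>T\<close> acts on functions rather than on equivalence classes; therefore \<open>T f\<close> need not vanish a.e. for
  trivial reasons. Adding large multiples of \<open>f\<close> to a function of norm 1 does not change its norm.
\<close>

lemma level_null:
  assumes f: "f \<in> L_Phi \<Phi>" and 0: "AE x in lebesgue. f x = 0"
  shows "emeasure lebesgue (unit_cube \<inter> level f 1) = 0"
proof -
  have le: "emeasure lebesgue (unit_cube \<inter> level f 1) \<le> ennreal e" if e: "e > 0" for e :: real
  proof -
    obtain l where l: "l > 0" and
      small: "\<And>g. g \<in> L_Phi \<Phi> \<Longrightarrow> Phi_norm \<Phi> g = 1 \<Longrightarrow> emeasure lebesgue (unit_cube \<inter> level g l) \<le> ennreal (e / 2)"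
      using level_small[of "e / 2"] e by auto
    obtain g :: "('n, 'b) fn" where g: "g \<in> L_Phi \<Phi>" "Phi_norm \<Phi> g = 1"
      using exists_Phi_norm_eq_1 by auto
    \<comment> \<open>Where |T f| > 1, homogeneity gives |T (k f)| > 2 l, so |T (k f + g)| or |T g|
      must exceed l. Both functions have norm 1, and each contributes at most e / 2.\<close>
    define k where "k = (of_real (2 * l) :: 'b)"
    note kf = L_Phi_cmult[OF f, of k]
    have h: "(\<lambda>x. k * f x + g x) \<in> L_Phi \<Phi>"
      using kf g by (intro L_Phi_add)
    have "Phi_norm \<Phi> (\<lambda>x. k * f x + g x) = Phi_norm \<Phi> g"
      unfolding Phi_norm_def by (intro nn_integral_cong_AE) (use 0 in eventually_elim, auto)
    then have h1: "Phi_norm \<Phi> (\<lambda>x. k * f x + g x) = 1" using g by simp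
    have "AE x in lebesgue. norm (T (\<lambda>y. (k * f y + g y) - g y) x) \<le> norm (T (\<lambda>y. k * f y + g y) x) + norm (T g x)"
      by (rule T_diff_le[OF h g(1)])
    then have "AE x in lebesgue. 2 * l * norm (T f x) \<le> norm (T (\<lambda>y. k * f y + g y) x) + norm (T g x)"
      using T_cmult[OF f, of k] by eventually_elim (use l in \<open>simp add: k_def norm_mult\<close>)
    then have "AE x in lebesgue. x \<in> unit_cube \<inter> level f 1 \<longrightarrow>
        x \<in> (unit_cube \<inter> level (\<lambda>y. k * f y + g y) l) \<union> (unit_cube \<inter> level g l)"
    proof eventually_elim
      case (elim x)
      have "2 * l * 1 < 2 * l * norm (T f x)" if "norm (T f x) > 1"
        using l that by (intro mult_strict_left_mono) auto
      then show ?case using elim by (auto simp: level_def)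
    qed
    then have "emeasure lebesgue (unit_cube \<inter> level f 1)
        \<le> emeasure lebesgue ((unit_cube \<inter> level (\<lambda>y. k * f y + g y) l) \<union> (unit_cube \<inter> level g l))"
      using h g by (intro emeasure_mono_AE) auto
    also have "\<dots> \<le> emeasure lebesgue (unit_cube \<inter> level (\<lambda>y. k * f y + g y) l) + emeasure lebesgue (unit_cube \<inter> level g l)"
      using h g by (intro emeasure_subadditive) auto
    also have "\<dots> \<le> ennreal (e / 2) + ennreal (e / 2)"
      using h h1 g by (intro add_mono small) auto
    also have "\<dots> = ennreal e" using e by (subst ennreal_plus[symmetric]) auto
    finally show ?thesis .
  qed
  have "emeasure lebesgue (unit_cube \<inter> level f 1) \<le> 0"
    by (rule ennreal_le_epsilon) (simp only: add_0_left le)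
  then show ?thesis by (simp only: le_zero_eq)
qed

text \<open>Let l be the threshold belonging to 1/8 and g = l f. If g has norm at least 1, the bound
  holds because the cube has measure 1; if the norm is 0, \<open>level_null\<close> applies.
  Otherwise some s >= 1 brings s g to norm 1, and |T (s g)| = s l |T f| > l wherever |T f| > 1. The
  margin 1/8 is later doubled and must then stay below 1/2, the part of the cube that gets
  covered.\<close>

lemma level_bound:
  "\<exists>c>0. \<forall>f\<in>L_Phi \<Phi>. emeasure lebesgue (unit_cube \<inter> level f 1) \<le> 1/8 + Phi_norm \<Phi> (\<lambda>x. of_real c * f x)"
proof -
  obtain l where l: "l > 0" and
    small: "\<And>g. g \<in> L_Phi \<Phi> \<Longrightarrow> Phi_norm \<Phi> g = 1 \<Longrightarrow> emeasure lebesgue (unit_cube \<inter> level g l) \<le> ennreal (1/8)"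
    using level_small[of "1/8", OF divide_pos_pos[OF zero_less_one zero_less_numeral]] by blast
  have "emeasure lebesgue (unit_cube \<inter> level f 1) \<le> 1/8 + Phi_norm \<Phi> (\<lambda>x. of_real l * f x)"
    if f: "f \<in> L_Phi \<Phi>" for f
  proof -
    define g where "g = (\<lambda>x. of_real l * f x)"
    have g: "g \<in> L_Phi \<Phi>" unfolding g_def by (rule L_Phi_cmult[OF f])
    consider "1 \<le> Phi_norm \<Phi> g" | "Phi_norm \<Phi> g = 0" | "Phi_norm \<Phi> g \<noteq> 0" "Phi_norm \<Phi> g \<le> 1"
      using linear by blast
    then have "emeasure lebesgue (unit_cube \<inter> level f 1) \<le> 1/8 + Phi_norm \<Phi> g"
    proof cases
      case 1
      then show ?thesis using emeasure_unit_cube_le[of "level f 1"]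
        by (intro add_increasing) (auto intro: order_trans)
    next
      case 2
      then have "AE x in lebesgue. g x = 0"
        using g by (subst (asm) Phi_norm_eq_0) (auto simp: L_Phi_def)
      then have "AE x in lebesgue. f x = 0"
        by eventually_elim (use l in \<open>auto simp: g_def\<close>)
      then show ?thesis using level_null[OF f] by simp
    next
      case 3
      obtain s where s: "s \<ge> 1" "Phi_norm \<Phi> (\<lambda>x. of_real s * g x) = 1"
        using Phi_norm_scale_eq_1[OF g 3] by auto
      have sg: "(\<lambda>x. of_real s * g x) \<in> L_Phi \<Phi>" by (rule L_Phi_cmult[OF g])
      have "AE x in lebesgue. norm (T (\<lambda>x. of_real s * g x) x) = (s * l) * norm (T f x)"
        using T_cmult[OF g, of "of_real s"] T_cmult[OF f, of "of_real l"]
        by eventually_elim (use s l in \<open>simp add: g_def\<close>)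
      then have "AE x in lebesgue. x \<in> unit_cube \<inter> level f 1 \<longrightarrow> x \<in> unit_cube \<inter> level (\<lambda>x. of_real s * g x) l"
      proof eventually_elim
        case (elim x)
        have "l * 1 < (s * l) * norm (T f x)" if "1 < norm (T f x)"
          using s l that by (intro mult_le_less_imp_less) auto
        then show ?case using elim by (auto simp: level_def)
      qed
      then have "emeasure lebesgue (unit_cube \<inter> level f 1) \<le> emeasure lebesgue (unit_cube \<inter> level (\<lambda>x. of_real s * g x) l)"
        using sg by (intro emeasure_mono_AE) auto
      also have "\<dots> \<le> ennreal (1/8)" by (rule small[OF sg s(2)])
      also have "\<dots> = 1/8" by (simp add: divide_ennreal[symmetric])
      finally show ?thesis by (intro add_increasing2) auto
    qed
    then show ?thesis by (simp add: g_def)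
  qed
  then show ?thesis using l by blast
qed

section \<open>Sums with random signs\<close>

definition signed_sum :: "nat \<Rightarrow> (nat \<Rightarrow> ('n, 'b) fn) \<Rightarrow> nat set \<Rightarrow> ('n, 'b) fn" where
  "signed_sum N f A = (\<lambda>x. \<Sum>i<N. if i \<in> A then f i x else - f i x)"

lemma L_Phi_signed_sum:
  assumes "\<And>i. i < N \<Longrightarrow> f i \<in> L_Phi \<Phi>"
  shows "signed_sum N f A \<in> L_Phi \<Phi>"
  unfolding signed_sum_def
proof (rule L_Phi_sum)
  fix i assume "i \<in> {..<N}"
  then have i: "f i \<in> L_Phi \<Phi>" using assms by blast
  show "(\<lambda>x. if i \<in> A then f i x else - f i x) \<in> L_Phi \<Phi>"
  proof (cases "i \<in> A")
    case True
    then show ?thesis using i by simp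
  next
    case False
    then show ?thesis using L_Phi_cmult[OF i, of "-1"] by simp
  qed
qed simp

definition flip :: "nat \<Rightarrow> nat set \<Rightarrow> nat set" where
  "flip j A = (if j \<in> A then A - {j} else insert j A)"

lemma mem_flip: "i \<in> flip j A \<longleftrightarrow> (if i = j then i \<notin> A else i \<in> A)"
  by (auto simp: flip_def)

lemma signed_sum_flip:
  assumes "j < N"
  shows "signed_sum N f A x - signed_sum N f (flip j A) x = (if j \<in> A then 2 else -2) * f j x"
proof -
  have "(if i \<in> A then f i x else - f i x) - (if i \<in> flip j A then f i x else - f i x)
      = (if i = j then (if j \<in> A then 2 else -2) * f j x else 0)" for i
  proof -
    have "u - - u = 2 * u" "- u - u = - 2 * u" for u :: 'b
      by (simp_all only: mult_2 mult_minus_left minus_minus minus_add_distrib diff_conv_add_uminus)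
    then show ?thesis
      unfolding mem_flip by (auto simp del: mult_minus_left minus_mult_left)
  qed
  then have "signed_sum N f A x - signed_sum N f (flip j A) x
      = (\<Sum>i<N. if i = j then (if j \<in> A then 2 else -2) * f j x else 0)"
    unfolding signed_sum_def sum_subtractf[symmetric] by (simp only:)
  also have "\<dots> = (if j \<in> A then 2 else -2) * f j x"
    using assms by (subst sum.delta) auto
  finally show ?thesis .
qed

lemma bij_betw_flip:
  assumes "j < N"
  shows "bij_betw (flip j) (Pow {..<N}) (Pow {..<N})"
  by (rule bij_betw_byWitness[where f' = "flip j"]) (use assms in \<open>auto simp: flip_def\<close>)

lemma Phi_norm_signed_sum_le:
  assumes f: "\<And>i. i < N \<Longrightarrow> f i \<in> L_Phi \<Phi>"
  shows "(\<Sum>A\<in>Pow {..<N}. Phi_norm \<Phi> (\<lambda>x. c * signed_sum N f A x)) \<le> 2 ^ N * (\<Sum>i<N. Phi_norm \<Phi> (\<lambda>x. c * f i x))"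
proof -
  have [measurable]: "f i \<in> borel_measurable lebesgue" if "i < N" for i
    using f[OF that] by (simp add: L_Phi_def)
  have [measurable]: "signed_sum N f A \<in> borel_measurable lebesgue" for A
    using L_Phi_signed_sum[of N f A] f by (simp add: L_Phi_def)
  have "(\<Sum>A\<in>Pow {..<N}. Phi_norm \<Phi> (\<lambda>x. c * signed_sum N f A x))
      = (\<integral>\<^sup>+x. (\<Sum>A\<in>Pow {..<N}. ennreal (\<Phi> (norm (c * signed_sum N f A x)))) \<partial>lebesgue)"
    unfolding Phi_norm_def by (subst nn_integral_sum) auto
  also have "\<dots> \<le> (\<integral>\<^sup>+x. 2 ^ N * (\<Sum>i<N. ennreal (\<Phi> (norm (c * f i x)))) \<partial>lebesgue)"
  proof (intro nn_integral_mono)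
    fix x
    have eq: "c * signed_sum N f A x = (\<Sum>i<N. if i \<in> A then c * f i x else - (c * f i x))" for A
      unfolding signed_sum_def sum_distrib_left by (intro sum.cong) auto
    have "(\<Sum>A\<in>Pow {..<N}. ennreal (\<Phi> (norm (c * signed_sum N f A x))))
        = ennreal (\<Sum>A\<in>Pow {..<N}. \<Phi> (norm (c * signed_sum N f A x)))"
      by (simp add: nonneg)
    also have "\<dots> \<le> ennreal (2 ^ N * (\<Sum>i<N. \<Phi> (norm (c * f i x))))"
      unfolding eq by (intro ennreal_leI sum_signs_le)
    also have "\<dots> = 2 ^ N * (\<Sum>i<N. ennreal (\<Phi> (norm (c * f i x))))"
      by (simp add: ennreal_mult nonneg sum_nonneg ennreal_power[symmetric])
    finally show "(\<Sum>A\<in>Pow {..<N}. ennreal (\<Phi> (norm (c * signed_sum N f A x))))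
        \<le> 2 ^ N * (\<Sum>i<N. ennreal (\<Phi> (norm (c * f i x))))" .
  qed
  also have "\<dots> = 2 ^ N * (\<Sum>i<N. Phi_norm \<Phi> (\<lambda>x. c * f i x))"
    unfolding Phi_norm_def by (subst nn_integral_cmult, measurable) (subst nn_integral_sum, auto)
  finally show ?thesis .
qed

text \<open>Double counting of points and sign choices. Where |T (f j)| > 1, the sums F for A and
  for \<open>flip j A\<close> differ by 2 f j up to sign, so |T F| > 1 for at least one of the two.
  Hence every point of the union lies in the level sets of at least half of the 2^N sums.\<close>

lemma union_level_le:
  assumes f: "\<And>i. i < N \<Longrightarrow> f i \<in> L_Phi \<Phi>"
  shows "2 ^ N * emeasure lebesgue (unit_cube \<inter> (\<Union>j<N. level (f j) 1))
    \<le> 2 * (\<Sum>A\<in>Pow {..<N}. emeasure lebesgue (unit_cube \<inter> level (signed_sum N f A) 1))"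
proof -
  let ?F = "signed_sum N f"
  have F: "?F A \<in> L_Phi \<Phi>" for A using f by (rule L_Phi_signed_sum)
  have U [measurable]: "unit_cube \<inter> (\<Union>j<N. level (f j) 1) \<in> sets lebesgue"
    using f by auto
  have FL [measurable]: "unit_cube \<inter> level (?F A) 1 \<in> sets lebesgue" for A
    using F by auto
  have "AE x in lebesgue. 2 * norm (T (f j) x) \<le> norm (T (?F A) x) + norm (T (?F (flip j A)) x)"
    if j: "j < N" for j A
  proof -
    define c :: 'b where "c = (if j \<in> A then 2 else -2)"
    have "norm c = 2" by (simp add: c_def)
    have "(\<lambda>x. ?F A x - ?F (flip j A) x) = (\<lambda>x. c * f j x)"
      using signed_sum_flip[OF j] by (auto simp: c_def)
    then show ?thesis
      using T_diff_le[OF F F, of A "flip j A"] T_cmult[OF f[OF j], of c]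
      by (auto elim!: eventually_elim2 simp: \<open>norm c = 2\<close>)
  qed
  \<comment> \<open>The index j will depend on the point x, so the null sets of all finitely many
    pairs (j, A) are discarded at once.\<close>
  then have "AE x in lebesgue. \<forall>j\<in>{..<N}. \<forall>A\<in>Pow {..<N}.
      2 * norm (T (f j) x) \<le> norm (T (?F A) x) + norm (T (?F (flip j A)) x)"
    by (intro AE_finite_allI) auto
  then have "AE x in lebesgue. 2 ^ N * indicator (unit_cube \<inter> (\<Union>j<N. level (f j) 1)) x
      \<le> 2 * (\<Sum>A\<in>Pow {..<N}. indicator (unit_cube \<inter> level (?F A) 1) x :: ennreal)"
  proof eventually_elim
    case (elim x)
    show ?case
    proof (cases "x \<in> unit_cube \<inter> (\<Union>j<N. level (f j) 1)")
      case True
      then obtain j where j: "j < N" "norm (T (f j) x) > 1" by (auto simp: level_def)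
      define i where "i A = (indicator (unit_cube \<inter> level (?F A) 1) x :: ennreal)" for A
      have "2 ^ N = (\<Sum>A\<in>Pow {..<N}. 1 :: ennreal)"
        by (simp add: card_Pow)
      also have "\<dots> \<le> (\<Sum>A\<in>Pow {..<N}. i A + i (flip j A))"
      proof (intro sum_mono)
        fix A assume "A \<in> Pow {..<N}"
        then have "2 * norm (T (f j) x) \<le> norm (T (?F A) x) + norm (T (?F (flip j A)) x)"
          using elim j by auto
        then have "norm (T (?F A) x) > 1 \<or> norm (T (?F (flip j A)) x) > 1"
          using j by linarith
        then show "1 \<le> i A + i (flip j A)"
          using True by (auto simp: i_def level_def)
      qed
      \<comment> \<open>\<open>flip j\<close> permutes the sign choices, so the flipped terms have
        the same sum.\<close>
      also have "\<dots> = 2 * (\<Sum>A\<in>Pow {..<N}. i A)"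
        using sum.reindex_bij_betw[OF bij_betw_flip[OF j(1)], of i]
        by (simp add: sum.distrib mult_2)
      finally show ?thesis using True by (simp add: i_def)
    qed simp
  qed
  then have "(\<integral>\<^sup>+x. 2 ^ N * indicator (unit_cube \<inter> (\<Union>j<N. level (f j) 1)) x \<partial>lebesgue)
      \<le> (\<integral>\<^sup>+x. 2 * (\<Sum>A\<in>Pow {..<N}. indicator (unit_cube \<inter> level (?F A) 1) x) \<partial>lebesgue)"
    by (rule nn_integral_mono_AE)
  also have "\<dots> = 2 * (\<Sum>A\<in>Pow {..<N}. emeasure lebesgue (unit_cube \<inter> level (?F A) 1))"
    by (simp add: nn_integral_cmult nn_integral_sum del: emeasure_completion)
  finally show ?thesis
    by (simp add: nn_integral_cmult del: emeasure_completion)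
qed

text \<open>\<open>level_bound\<close> is applied to each signed sum in
  \<open>union_level_le\<close>, and \<open>Phi_norm_signed_sum_le\<close> controls the total of the
  norms. Both sides carry the number 2^N of sign choices, which cancels, so c does not depend on
  N.\<close>

lemma union_level_bound:
  "\<exists>c>0. \<forall>(N::nat) f. (\<forall>i<N. f i \<in> L_Phi \<Phi>) \<longrightarrow>
     emeasure lebesgue (unit_cube \<inter> (\<Union>j<N. level (f j) 1)) \<le> 1/4 + 2 * (\<Sum>i<N. Phi_norm \<Phi> (\<lambda>x. of_real c * f i x))"
proof -
  obtain c where c: "c > 0" and
    bound: "\<And>f. f \<in> L_Phi \<Phi> \<Longrightarrow> emeasure lebesgue (unit_cube \<inter> level f 1) \<le> 1/8 + Phi_norm \<Phi> (\<lambda>x. of_real c * f x)"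
    using level_bound by metis
  have "emeasure lebesgue (unit_cube \<inter> (\<Union>j<N. level (f j) 1)) \<le> 1/4 + 2 * (\<Sum>i<N. Phi_norm \<Phi> (\<lambda>x. of_real c * f i x))"
    if f: "\<forall>i<N. f i \<in> L_Phi \<Phi>" for N :: nat and f
  proof -
    let ?W = "\<Sum>i<N. Phi_norm \<Phi> (\<lambda>x. of_real c * f i x)"
    have "2 ^ N * emeasure lebesgue (unit_cube \<inter> (\<Union>j<N. level (f j) 1))
        \<le> 2 * (\<Sum>A\<in>Pow {..<N}. emeasure lebesgue (unit_cube \<inter> level (signed_sum N f A) 1))"
      using f by (intro union_level_le) auto
    also have "\<dots> \<le> 2 * (\<Sum>A\<in>Pow {..<N}. 1/8 + Phi_norm \<Phi> (\<lambda>x. of_real c * signed_sum N f A x))"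
      using f by (intro mult_left_mono sum_mono bound L_Phi_signed_sum) auto
    also have "\<dots> \<le> 2 * (2 ^ N * (1/8) + 2 ^ N * ?W)"
    proof -
      have "(\<Sum>A\<in>Pow {..<N}. Phi_norm \<Phi> (\<lambda>x. of_real c * signed_sum N f A x)) \<le> 2 ^ N * ?W"
        using f by (intro Phi_norm_signed_sum_le) auto
      then show ?thesis
        unfolding sum.distrib by (intro mult_left_mono add_mono) (simp_all add: card_Pow)
    qed
    also have "\<dots> = 2 ^ N * (2 * (1/8) + 2 * ?W)"
      by (simp only: distrib_left mult.left_commute[of 2])
    also have "2 * (1/8) = (1/4 :: ennreal)"
    proof -
      have "ennreal 2 * ennreal (1/8) = ennreal (1/4)"
        by (simp add: ennreal_mult[symmetric] del: ennreal_numeral)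
      then show ?thesis by (simp add: divide_ennreal[symmetric])
    qed
    finally show ?thesis
      by (rule ennreal_mult_le_mult_iff[THEN iffD1, rotated 2]) (simp_all add: power_eq_top_ennreal)
  qed
  then show ?thesis using c by blast
qed


section \<open>From the unit cube to the whole space by translation and dilation\<close>

lemma Phi_norm_affine:
  fixes f :: "('n, 'b) fn"
  assumes [measurable]: "f \<in> borel_measurable lebesgue" and "r \<noteq> 0"
  shows "Phi_norm \<Phi> f = ennreal (\<bar>r\<bar> ^ DIM(real^'n)) * Phi_norm \<Phi> (\<lambda>x. f (t + r *\<^sub>R x))"
  unfolding Phi_norm_def using assms by (intro nn_integral_lebesgue_affine) auto

lemma L_Phi_affine:
  fixes f :: "('n, 'b) fn"
  assumes f: "f \<in> L_Phi \<Phi>" and r: "r \<noteq> 0"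
  shows "(\<lambda>x. f (t + r *\<^sub>R x)) \<in> L_Phi \<Phi>"
proof -
  have [measurable]: "f \<in> borel_measurable lebesgue" using f by (simp add: L_Phi_def)
  note [measurable] = lebesgue_scaleR_affine_measurable[OF r, of t]
  have "ennreal (\<bar>r\<bar> ^ DIM(real^'n)) * Phi_norm \<Phi> (\<lambda>x. f (t + r *\<^sub>R x)) < \<infinity>"
    using f Phi_norm_affine[of f r t] r by (simp add: L_Phi_def)
  then have "Phi_norm \<Phi> (\<lambda>x. f (t + r *\<^sub>R x)) < \<infinity>"
    using r by (auto simp: ennreal_mult_less_top simp del: DIM_cart)
  then show ?thesis by (simp add: L_Phi_def)
qed

lemma translate_eq_affine: "translate h f = (\<lambda>x. f (- h + 1 *\<^sub>R x))"
  by (simp add: translate_def)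

lemma dilate_eq_affine: "dilate r f = (\<lambda>x. f (0 + r *\<^sub>R x))"
  by (simp add: dilate_def)

text \<open>Let m be the measure of the level set in the cube. About 3^n / m of its translates cover
  half of the unit cube, and the corresponding translates of g all have the same norm W after
  scaling by c. Then \<open>union_level_bound\<close> reads 1/2 <= 1/4 + 2 N W, a lower bound for W
  in terms of m.\<close>

lemma symmetric_cube_bound:
  "\<exists>c>0. \<forall>g\<in>L_Phi \<Phi>. emeasure lebesgue (cbox (-One) One \<inter> level g 1)
     \<le> ennreal (16 * 3 ^ DIM(real^'n)) * Phi_norm \<Phi> (\<lambda>x. of_real c * g x)"
proof -
  obtain c where c: "c > 0" and bound: "\<And>(N::nat) f. \<forall>i<N. f i \<in> L_Phi \<Phi> \<Longrightarrow>
     emeasure lebesgue (unit_cube \<inter> (\<Union>j<N. level (f j) 1)) \<le> 1/4 + 2 * (\<Sum>i<N. Phi_norm \<Phi> (\<lambda>x. of_real c * f i x))"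
    using union_level_bound by metis
  have "emeasure lebesgue (cbox (-One) One \<inter> level g 1) \<le> ennreal (16 * 3 ^ DIM(real^'n)) * Phi_norm \<Phi> (\<lambda>x. of_real c * g x)"
    if g: "g \<in> L_Phi \<Phi>" for g
  proof -
    define d where "d = DIM(real^'n)"
    define D where "D = cbox (-One) One \<inter> level g 1"
    have D: "D \<in> sets lebesgue" unfolding D_def using g by auto
    \<comment> \<open>The covering lemma needs a Borel set; the main part is a Borel subset of
      \<open>D\<close> with the same measure.\<close>
    define S where "S = main_part lborel D"
    have S [measurable]: "S \<in> sets borel" using main_part_sets[OF D] by (simp add: S_def)
    have SD: "S \<subseteq> D" using main_part_null_part_Un[OF D] by (auto simp: S_def)
    define m where "m = measure lborel S"
    have cube: "emeasure lborel (cbox (-One) (One :: real^'n)) \<le> ennreal (3 ^ d)"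
      unfolding d_def by (rule emeasure_symmetric_cbox_le)
    have "emeasure lborel S \<le> ennreal (3 ^ d)"
      using SD by (intro order_trans[OF emeasure_mono cube]) (auto simp: D_def)
    moreover from this have em: "emeasure lborel S = ennreal m"
      unfolding m_def by (intro emeasure_eq_ennreal_measure) (auto simp: top_unique)
    ultimately have m3: "m \<le> 3 ^ d"
      by simp
    have eD: "emeasure lebesgue D = ennreal m"
      using D em by (simp add: emeasure_completion S_def)
    have cg: "(\<lambda>x. of_real c * g x) \<in> L_Phi \<Phi>" by (rule L_Phi_cmult[OF g])
    then obtain W where W: "W \<ge> 0" "Phi_norm \<Phi> (\<lambda>x. of_real c * g x) = ennreal W"
      by (cases "Phi_norm \<Phi> (\<lambda>x. of_real c * g x)") (auto simp: L_Phi_def)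
    have "m \<le> 16 * 3 ^ d * W"
    proof (cases "m > 0")
      case False
      moreover have "0 \<le> 16 * 3 ^ d * W" using W by simp
      ultimately show ?thesis by linarith
    next
      case True
      \<comment> \<open>N m >= 3^d makes the covering reach one half. Rounding up costs at most m <=
        3^d, so N m stays below 2 * 3^d.\<close>
      define N where "N = nat \<lceil>3 ^ d / m\<rceil>"
      have N1: "3 ^ d \<le> N * m"
      proof -
        have "3 ^ d / m \<le> N" unfolding N_def by linarith
        then show ?thesis using True by (simp add: field_simps)
      qed
      have N2: "N * m \<le> 2 * 3 ^ d"
      proof -
        have "0 \<le> 3 ^ d / m" using True by simp
        then have "N \<le> 3 ^ d / m + 1" unfolding N_def by linarith
        then have "N * m \<le> (3 ^ d / m + 1) * m" using True by (intro mult_right_mono) auto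
        also have "\<dots> = 3 ^ d + m" using True by (simp add: field_simps)
        finally show ?thesis using m3 by simp
      qed
      obtain h :: "nat \<Rightarrow> real^'n" where
        h: "measure lborel (cbox 0 One - (\<Union>i<N. {x. x - h i \<in> S})) \<le> max (1/2) (1 - N * m / (2 * 3 ^ d))"
        using unit_cube_cover[OF S, of N] SD by (auto simp: D_def m_def d_def)
      define V where "V = cbox 0 One \<inter> (\<Union>i<N. {x. x - h i \<in> S})"
      have [measurable]: "V \<in> sets borel" unfolding V_def by measurable
      have "1/2 \<le> measure lborel V"
      proof -
        have "1 - N * m / (2 * 3 ^ d) \<le> 1/2"
          using N1 by (simp add: field_simps)
        then have "measure lborel (cbox 0 One - (\<Union>i<N. {x. x - h i \<in> S})) \<le> 1/2"
          using h by simp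
        moreover have "cbox 0 One - (\<Union>i<N. {x. x - h i \<in> S}) = cbox 0 One - V"
          by (auto simp: V_def)
        moreover have "measure lborel (cbox 0 One - V) = 1 - measure lborel V"
          by (subst measure_Diff) (auto simp: V_def measure_unit_cbox emeasure_unit_cbox)
        ultimately show ?thesis by simp
      qed
      moreover have "emeasure lborel V = ennreal (measure lborel V)"
        using emeasure_mono[of V "cbox 0 One" lborel]
        by (intro emeasure_eq_ennreal_measure) (auto simp: V_def emeasure_unit_cbox top_unique)
      then have "emeasure lebesgue V = ennreal (measure lborel V)"
        by (simp add: emeasure_completion)
      ultimately have half: "ennreal (1/2) \<le> emeasure lebesgue V"
        by (simp only: ennreal_leI)
      define f where "f i = translate (h i) g" for i
      have f: "f i \<in> L_Phi \<Phi>" for i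
        unfolding f_def translate_eq_affine by (rule L_Phi_affine[OF g]) simp
      have "AE x in lebesgue. \<forall>i\<in>{..<N}. T (f i) x = T g (x - h i)"
      proof (intro AE_finite_allI)
        fix i
        show "AE x in lebesgue. T (f i) x = T g (x - h i)"
          using translation g unfolding translation_invariant_on_def f_def
          by (auto simp: translate_def[of _ "T g"])
      qed simp
      then have AE: "AE x in lebesgue. x \<in> V \<longrightarrow> x \<in> unit_cube \<inter> (\<Union>j<N. level (f j) 1)"
      proof eventually_elim
        case (elim x)
        show ?case
        proof
          assume "x \<in> V"
          then obtain i where i: "i < N" "x - h i \<in> S" and x: "x \<in> unit_cube"
            by (auto simp: V_def unit_cube_def)
          then have "x - h i \<in> level g 1" using SD by (auto simp: D_def)
          then have "x \<in> level (f i) 1" using elim i by (auto simp: level_def)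
          then show "x \<in> unit_cube \<inter> (\<Union>j<N. level (f j) 1)" using i x by auto
        qed
      qed
      have norm_f: "Phi_norm \<Phi> (\<lambda>x. of_real c * f i x) = ennreal W" for i
        using Phi_norm_affine[of "\<lambda>x. of_real c * g x" 1 "- h i"] cg W
        by (simp add: L_Phi_def f_def translate_def)
      note half
      also have "emeasure lebesgue V \<le> emeasure lebesgue (unit_cube \<inter> (\<Union>j<N. level (f j) 1))"
        using f AE by (intro emeasure_mono_AE) auto
      also have "\<dots> \<le> 1/4 + 2 * (\<Sum>i<N. Phi_norm \<Phi> (\<lambda>x. of_real c * f i x))"
        using f by (intro bound) auto
      also have "\<dots> = ennreal (1/4) + 2 * (\<Sum>i<N. ennreal W)"
        by (simp add: norm_f divide_ennreal[symmetric])
      also have "\<dots> = ennreal (1/4 + 2 * (N * W))"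
        using W by (simp add: ennreal_mult ennreal_of_nat_eq_real_of_nat)
      finally have "1/2 \<le> 1/4 + 2 * (N * W)"
        using W by (subst (asm) ennreal_le_iff) auto
      \<comment> \<open>Multiplying by m trades N for N m <= 2 * 3^d; the constant 16 is 8 *
        2.\<close>
      then have "m * (1/8) \<le> m * (N * W)"
        using True by (intro mult_left_mono) auto
      also have "\<dots> = (N * m) * W" by simp
      also have "\<dots> \<le> (2 * 3 ^ d) * W"
        using N2 W by (intro mult_right_mono) auto
      finally show ?thesis by simp
    qed
    then have "ennreal m \<le> ennreal (16 * 3 ^ d) * ennreal W"
      using W by (simp flip: ennreal_mult add: ennreal_leI)
    then show ?thesis using eD W by (simp add: D_def d_def)
  qed
  then show ?thesis using c by blast
qed

text \<open>Dilation by r carries the level set in [-r,r]^n to one in [-1,1]^n. Both sides of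
  \<open>symmetric_cube_bound\<close> scale by r^n, so the constant is the same for every r, and the
  cubes exhaust the space.\<close>

lemma level_1_bound:
  "\<exists>c>0. \<forall>f\<in>L_Phi \<Phi>. emeasure lebesgue (level f 1)
     \<le> ennreal (16 * 3 ^ DIM(real^'n)) * Phi_norm \<Phi> (\<lambda>x. of_real c * f x)"
proof -
  define K where "K = ennreal (16 * 3 ^ DIM(real^'n))"
  obtain c where c: "c > 0" and bound: "\<And>g. g \<in> L_Phi \<Phi> \<Longrightarrow>
     emeasure lebesgue (cbox (-One) One \<inter> level g 1) \<le> K * Phi_norm \<Phi> (\<lambda>x. of_real c * g x)"
    using symmetric_cube_bound unfolding K_def by metis
  have "emeasure lebesgue (level f 1) \<le> K * Phi_norm \<Phi> (\<lambda>x. of_real c * f x)"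
    if f: "f \<in> L_Phi \<Phi>" for f
  proof -
    define Q where "Q r = cbox (- (r *\<^sub>R One)) (r *\<^sub>R One :: real^'n)" for r
    have Q: "Q r = {x. \<forall>b\<in>Basis. \<bar>x \<bullet> b\<bar> \<le> r}" for r
      by (auto simp: Q_def cbox_def inner_simps abs_le_iff minus_le_iff)
    have [measurable]: "Q r \<in> sets lebesgue" for r by (simp add: Q_def)
    have [measurable]: "level f 1 \<in> sets lebesgue" using f by auto
    have cube: "emeasure lebesgue (Q r \<inter> level f 1) \<le> K * Phi_norm \<Phi> (\<lambda>x. of_real c * f x)"
      if r: "r > 0" for r
    proof -
      define g where "g = dilate r f"
      define R where "R = ennreal (\<bar>r\<bar> ^ DIM(real^'n))"
      have g: "g \<in> L_Phi \<Phi>"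
        unfolding g_def dilate_eq_affine using r by (intro L_Phi_affine[OF f]) auto
      have "AE x in lebesgue. T g x = T f (r *\<^sub>R x)"
        using dilation f r unfolding dilation_invariant_on_def g_def
        by (auto simp: dilate_def[of _ "T f"])
      then have AE: "AE x in lebesgue. indicator (Q r \<inter> level f 1) (r *\<^sub>R x)
          = (indicator (cbox (-One) One \<inter> level g 1) x :: ennreal)"
      proof eventually_elim
        case (elim x)
        have "r *\<^sub>R x \<in> Q r \<longleftrightarrow> x \<in> Q 1"
          using r by (auto simp: Q abs_mult)
        then show ?case using elim by (auto simp: level_def Q_def split: split_indicator)
      qed
      have "emeasure lebesgue (Q r \<inter> level f 1) = (\<integral>\<^sup>+x. indicator (Q r \<inter> level f 1) x \<partial>lebesgue)"
        by simp
      also have "\<dots> = R * (\<integral>\<^sup>+x. indicator (Q r \<inter> level f 1) (0 + r *\<^sub>R x) \<partial>lebesgue)"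
        unfolding R_def using r by (intro nn_integral_lebesgue_affine) auto
      also have "(\<integral>\<^sup>+x. indicator (Q r \<inter> level f 1) (0 + r *\<^sub>R x) \<partial>lebesgue)
          = (\<integral>\<^sup>+x. indicator (cbox (-One) One \<inter> level g 1) x \<partial>lebesgue)"
        using AE by (intro nn_integral_cong_AE) simp
      also have "\<dots> = emeasure lebesgue (cbox (-One) One \<inter> level g 1)"
        using g by (intro nn_integral_indicator) auto
      also have "\<dots> \<le> K * Phi_norm \<Phi> (\<lambda>x. of_real c * g x)"
        by (rule bound[OF g])
      finally have "emeasure lebesgue (Q r \<inter> level f 1) \<le> K * (R * Phi_norm \<Phi> (\<lambda>x. of_real c * g x))"
        by (simp add: mult_left_mono mult.left_commute)
      also have "R * Phi_norm \<Phi> (\<lambda>x. of_real c * g x) = Phi_norm \<Phi> (\<lambda>x. of_real c * f x)"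
        using Phi_norm_affine[of "\<lambda>x. of_real c * f x" r 0] r L_Phi_cmult[OF f, of "of_real c"]
        by (simp add: R_def g_def dilate_def L_Phi_def)
      finally show ?thesis .
    qed
    have "level f 1 = (\<Union>k::nat. Q (Suc k) \<inter> level f 1)"
    proof -
      have "\<exists>k::nat. x \<in> Q (Suc k)" for x
      proof -
        obtain k :: nat where "norm x \<le> k" using real_arch_simple by blast
        then have "x \<in> Q (Suc k)"
          using Basis_le_norm[of _ x] by (fastforce simp: Q)
        then show ?thesis by blast
      qed
      then show ?thesis by blast
    qed
    also have "emeasure lebesgue \<dots> = (SUP k::nat. emeasure lebesgue (Q (Suc k) \<inter> level f 1))"
      by (intro SUP_emeasure_incseq[symmetric]) (force simp: incseq_def Q)+
    also have "\<dots> \<le> K * Phi_norm \<Phi> (\<lambda>x. of_real c * f x)"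
      by (intro SUP_least cube) simp
    finally show ?thesis .
  qed
  then show ?thesis using c unfolding K_def by blast
qed

lemma level_scale:
  assumes f: "f \<in> L_Phi \<Phi>" and l: "l > 0"
  shows "emeasure lebesgue (level f l) = emeasure lebesgue (level (\<lambda>x. of_real (1 / l) * f x) 1)"
proof (rule emeasure_eq_AE)
  define g where "g = (\<lambda>x. of_real (1 / l) * f x)"
  have g: "g \<in> L_Phi \<Phi>" unfolding g_def by (rule L_Phi_cmult[OF f])
  have "AE x in lebesgue. norm (T g x) = norm (of_real (1 / l) :: 'b) * norm (T f x)"
    unfolding g_def by (rule T_cmult[OF f])
  then have "AE x in lebesgue. x \<in> level f l \<longleftrightarrow> x \<in> level g 1"
  proof eventually_elim
    case (elim x)
    then have "norm (T f x) = l * norm (T g x)"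
      using l by (simp add: norm_divide field_simps)
    then show ?case
      using l by (simp add: level_def mult_less_cancel_left1)
  qed
  then show "AE x in lebesgue. x \<in> level f l \<longleftrightarrow> x \<in> level (\<lambda>x. of_real (1 / l) * f x) 1"
    by (simp only: g_def)
qed (rule sets_level, rule f L_Phi_cmult[OF f])+

end

section \<open>Absorbing the constant into the argument of \<open>\<Phi>\<close>\<close>

theorem theorem8:
  fixes \<Phi> :: "real \<Rightarrow> real"
    and T :: "(real ^ 'n::finite \<Rightarrow> 'b::{real_normed_field, euclidean_space}) \<Rightarrow> (real ^ 'n \<Rightarrow> 'b)"
  assumes "\<And>t. t \<ge> 0 \<Longrightarrow> \<Phi> t \<ge> 0"
    and "continuous_on {0..} \<Phi>"
    and "mono_on {0..} \<Phi>" and "\<Phi> 0 = 0"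
    and "concave_on {0..} (\<lambda>t. \<Phi> (sqrt t))"
    and "\<exists>b :: real \<Rightarrow> real. (\<forall>l\<ge>1. b l \<ge> 0) \<and> (b \<longlongrightarrow> 0) at_top \<and>
           (\<forall>l\<ge>1. \<forall>t\<ge>0. \<Phi> (inverse l * t) \<le> b l * \<Phi> t)"
    and "filterlim \<Phi> at_top at_top"
    and "\<And>f. f \<in> L_Phi \<Phi> \<Longrightarrow> T f \<in> borel_measurable lebesgue"
    and "sublinear_on (L_Phi \<Phi>) T"
    and "continuous_in_measure \<Phi> T"
    and "translation_invariant_on (L_Phi \<Phi>) T"
    and "dilation_invariant_on (L_Phi \<Phi>) T"
  shows "\<exists>A>0. \<forall>l>0. \<forall>f\<in>L_Phi \<Phi>.
           emeasure lebesgue {x. norm (T f x) > l}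
             \<le> (\<integral>\<^sup>+ x. ennreal (\<Phi> (A * norm (f x) / l)) \<partial>lebesgue)"
proof -
  interpret invariant_operator \<Phi> T
    by unfold_locales (use assms in auto)
  define K :: real where "K = 16 * 3 ^ DIM(real^'n)"
  have K: "K > 0" by (simp add: K_def)
  obtain c where c: "c > 0" and bound: "\<And>f. f \<in> L_Phi \<Phi> \<Longrightarrow>
      emeasure lebesgue (level f 1) \<le> ennreal K * Phi_norm \<Phi> (\<lambda>x. of_real c * f x)"
    using level_1_bound unfolding K_def by metis
  obtain b :: "real \<Rightarrow> real" where b: "(b \<longlongrightarrow> 0) at_top"
    "\<And>l t. l \<ge> 1 \<Longrightarrow> t \<ge> 0 \<Longrightarrow> \<Phi> (inverse l * t) \<le> b l * \<Phi> t"
    using assms(6) by blast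
  \<comment> \<open>For such an \<open>a\<close>, condition (3) at the point a t gives
    \<open>\<Phi> t\<close> <= \<open>b a * \<Phi> (a * t)\<close>, so the factor K is paid for by
    enlarging the argument a times. The final constant is \<open>a * c\<close>.\<close>
  have "eventually (\<lambda>a. b a < 1 / K \<and> a \<ge> 1) at_top"
    using order_tendstoD(2)[OF b(1), of "1 / K"] K by (intro eventually_conj eventually_ge_at_top) simp
  then obtain a where a: "b a < 1 / K" "a \<ge> 1"
    using eventually_happens'[OF trivial_limit_at_top_linorder] by blast
  have absorb: "K * \<Phi> t \<le> \<Phi> (a * t)" if "t \<ge> 0" for t
  proof -
    have "\<Phi> t \<le> b a * \<Phi> (a * t)"
      using b(2)[of a "a * t"] a that by (simp add: mult.assoc[symmetric])
    also have "\<dots> \<le> 1 / K * \<Phi> (a * t)"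
      using a that by (intro mult_right_mono nonneg) auto
    finally show ?thesis using K by (simp add: field_simps)
  qed
  have "emeasure lebesgue {x. norm (T f x) > l} \<le> (\<integral>\<^sup>+ x. ennreal (\<Phi> (a * c * norm (f x) / l)) \<partial>lebesgue)"
    if l: "l > 0" and f: "f \<in> L_Phi \<Phi>" for l f
  proof -
    define g where "g = (\<lambda>x. of_real (1 / l) * f x)"
    have g: "g \<in> L_Phi \<Phi>" unfolding g_def by (rule L_Phi_cmult[OF f])
    have [measurable]: "g \<in> borel_measurable lebesgue" using g by (simp add: L_Phi_def)
    have "emeasure lebesgue {x. norm (T f x) > l} = emeasure lebesgue (level g 1)"
      using level_scale[OF f l] by (simp add: level_def g_def)
    also have "\<dots> \<le> ennreal K * Phi_norm \<Phi> (\<lambda>x. of_real c * g x)"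
      by (rule bound[OF g])
    also have "\<dots> = (\<integral>\<^sup>+x. ennreal K * ennreal (\<Phi> (norm (of_real c * g x))) \<partial>lebesgue)"
      unfolding Phi_norm_def by (subst nn_integral_cmult) auto
    also have "\<dots> \<le> (\<integral>\<^sup>+ x. ennreal (\<Phi> (a * c * norm (f x) / l)) \<partial>lebesgue)"
    proof (intro nn_integral_mono)
      fix x
      have "norm (of_real c * g x) = c * norm (f x) / l"
        using c l by (simp add: g_def norm_mult norm_divide)
      then show "ennreal K * ennreal (\<Phi> (norm (of_real c * g x))) \<le> ennreal (\<Phi> (a * c * norm (f x) / l))"
        using absorb[of "c * norm (f x) / l"] K c l
        by (simp add: nonneg ennreal_leI mult.assoc flip: ennreal_mult)
    qed
    finally show ?thesis .
  qed
  moreover have "a * c > 0" using a c by simp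
  ultimately show ?thesis by blast
qed

end
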